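(* Let $\{a_n\}_{n\ge 0}$ and $\{b_n\}_{n\ge 0}$ be real sequences with $a_n>0$ for all $n$, $a_n\to a$ and $b_n\to b$ with $a,b$ finite, and let $J$ be the associated Jacobi matrix, with spectral measure $\mu$, support $X$, orthonormal polynomials $\{p_n\}_{n\ge0}$, $s^+=\max\{\max X,0\}$, $\mathcal{J}=J-s^+I$, and $W_t$, $t\ge 0$, as defined in the context. Then for each $f\in\ell^2(\mathbb{N})$ the function $u(n,t)=W_tf(n)$ is well defined and is a solution of the initial-value problem $$\frac{\partial u(n,t)}{\partial t}=\mathcal{J}u(n,t),\quad n\ge 0,\ t\ge 0,\qquad u(n,0)=f(n),\quad n\ge 0,$$ where $\mathcal{J}$ acts on the variable $n$.
   Context: Here $\mathbb{N}=\{0,1,2,\dots\}$ and sequences are real-valued. The Jacobi matrix $J$ acts by $Jf(n)=a_{n-1}f(n-1)+b_nf(n)+a_nf(n+1)$ for $n\ge1$ and $Jf(0)=b_0f(0)+a_0f(1)$; $I$ is the identity. By Favard's theorem there are a positive Borel measure $\mu$ on $\mathbb{R}$ whose support $X$ is compact and infinite, and real polynomials $p_n$ of degree $n$ such that $\int_X p_np_m\,d\mu=\delta_{nm}$ and $xp_n(x)=a_{n-1}p_{n-1}(x)+b_np_n(x)+a_np_{n+1}(x)$ for $n\ge 0$, with $p_{-1}=0$; under the convergence assumptions on $a_n,b_n$ the measure is unique and $\{p_n\}_{n\ge0}$ is a complete orthonormal system in $L^2(X,\mu)$. For $t\ge 0$ put $$K_t(m,n)=\int_X e^{(x-s^+)t}p_m(x)p_n(x)\,d\mu(x),\qquad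 W_tf(n)=\sum_{m=0}^\infty f(m)K_t(m,n).$$ The derivative at $t=0$ is one-sided. *)

theory Defs
  imports "HOL-Analysis.Analysis" "HOL-Computational_Algebra.Polynomial"
begin

definition jacobi :: "(nat \<Rightarrow> real) \<Rightarrow> (nat \<Rightarrow> real) \<Rightarrow> (nat \<Rightarrow> real) \<Rightarrow> nat \<Rightarrow> real" where
  "jacobi a b f n =
     (if n = 0 then b 0 * f 0 + a 0 * f 1
      else a (n - 1) * f (n - 1) + b n * f n + a n * f (n + 1))"

definition measure_support :: "real measure \<Rightarrow> real set" where
  "measure_support M = {x. \<forall>U. open U \<longrightarrow> x \<in> U \<longrightarrow> emeasure M U > 0}"

text \<open>
  A pair of the kind provided by Favard's theorem. Finiteness of the measure need not be
  required: the case \<open>n = m = 0\<close> of orthonormality says that a constant function has integral 1,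
  which for the Bochner integral (0 on non-integrable functions) forces integrability.
  The same case excludes \<open>p 0 = 0\<close>, which the degree condition alone would allow.
\<close>

definition spectral_pair ::
    "(nat \<Rightarrow> real) \<Rightarrow> (nat \<Rightarrow> real) \<Rightarrow> real measure \<Rightarrow> (nat \<Rightarrow> real poly) \<Rightarrow> bool" where
  "spectral_pair a b M p \<longleftrightarrow>
     sets M = sets borel \<and>
     compact (measure_support M) \<and> infinite (measure_support M) \<and>
     (\<forall>n. degree (p n) = n) \<and>
     (\<forall>n m. (LINT x:measure_support M|M. poly (p n) x * poly (p m) x) = (if n = m then 1 else 0)) \<and>
     (\<forall>n x. x * poly (p n) x =
        (if n = 0 then 0 else a (n - 1) * poly (p (n - 1)) x)
        + b n * poly (p n) x + a n * poly (p (n + 1)) x)"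

definition s_plus :: "real measure \<Rightarrow> real" where
  "s_plus M = max (GREATEST x. x \<in> measure_support M) 0"

definition jacobi_shifted ::
    "(nat \<Rightarrow> real) \<Rightarrow> (nat \<Rightarrow> real) \<Rightarrow> real measure \<Rightarrow> (nat \<Rightarrow> real) \<Rightarrow> nat \<Rightarrow> real" where
  "jacobi_shifted a b M f n = jacobi a b f n - s_plus M * f n"

definition heat_integrand ::
    "real measure \<Rightarrow> (nat \<Rightarrow> real poly) \<Rightarrow> real \<Rightarrow> nat \<Rightarrow> nat \<Rightarrow> real \<Rightarrow> real" where
  "heat_integrand M p t m n x = exp ((x - s_plus M) * t) * poly (p m) x * poly (p n) x"

definition heat_kernel ::
    "real measure \<Rightarrow> (nat \<Rightarrow> real poly) \<Rightarrow> real \<Rightarrow> nat \<Rightarrow> nat \<Rightarrow> real" where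
  "heat_kernel M p t m n = (LINT x:measure_support M|M. heat_integrand M p t m n x)"

definition heat_op ::
    "real measure \<Rightarrow> (nat \<Rightarrow> real poly) \<Rightarrow> real \<Rightarrow> (nat \<Rightarrow> real) \<Rightarrow> nat \<Rightarrow> real" where
  "heat_op M p t f n = (\<Sum>m. f m * heat_kernel M p t m n)"

end

theory Submission
  imports Defs
begin

text \<open>
  Write \<open>X\<close> for the support, \<open>s\<close> for \<open>s_plus M\<close>, and \<open>E\<^sub>t x = exp ((x - s) * t)\<close>. For a fixed \<open>f\<close> in
  \<open>\<ell>\<^sup>2\<close> everything is governed by the single linear functional
  \<open>L g = (\<Sum>m. f m * (\<integral>\<^sub>X g p\<^sub>m d\<mu>))\<close> on continuous functions, because \<open>W\<^sub>t f n = L (E\<^sub>t p\<^sub>n)\<close>.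

  Bessel's inequality bounds the \<open>\<ell>\<^sup>2\<close> norm of the Fourier coefficients of \<open>g\<close> by its \<open>L\<^sup>2\<close> norm, so by
  Cauchy-Schwarz the series \<open>L g\<close> converges absolutely and \<open>\<bar>L g\<bar>\<close> is at most a constant times the
  supremum of \<open>\<bar>g\<bar>\<close> over \<open>X\<close> (lemmas \<open>bessel\<close> and \<open>pairing_bound\<close>). As \<open>X\<close> is bounded, the Taylor
  remainder of \<open>t \<mapsto> E\<^sub>t p\<^sub>n\<close> is quadratically small uniformly on \<open>X\<close>, so \<open>L\<close> may be differentiated
  through: the derivative of \<open>W\<^sub>t f n\<close> is \<open>L ((x - s) E\<^sub>t p\<^sub>n)\<close> (lemma \<open>pairing_exp_derivative\<close>).
  The three-term recurrence rewrites \<open>(x - s) p\<^sub>n\<close> as the shifted Jacobi matrix acting on \<open>n\<close>, and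
  linearity of \<open>L\<close> turns this into the differential equation. The initial value is
  \<open>L p\<^sub>n = f n\<close>, which is orthonormality.
\<close>

section \<open>Orthonormal systems of continuous functions on a compact set\<close>

locale continuous_orthonormal_system =
  fixes M :: "real measure" and X :: "real set" and e :: "nat \<Rightarrow> real \<Rightarrow> real"
  assumes sets_eq: "sets M = sets borel"
    and compact_X: "compact X"
    and one_integrable: "set_integrable M X (\<lambda>_. 1 :: real)"
    and e_continuous: "\<And>m. continuous_on UNIV (e m)"
    and orthonormal: "\<And>n m. (LINT x:X|M. e n x * e m x) = (if n = m then 1 else 0)"
begin

definition fourier_coeff :: "(real \<Rightarrow> real) \<Rightarrow> nat \<Rightarrow> real" where
  "fourier_coeff g m = (LINT x:X|M. g x * e m x)"

definition pairing :: "(nat \<Rightarrow> real) \<Rightarrow> (real \<Rightarrow> real) \<Rightarrow> real" where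
  "pairing f g = (\<Sum>m. f m * fourier_coeff g m)"

lemma continuous_integrable:
  fixes g :: "real \<Rightarrow> real"
  assumes "continuous_on UNIV g"
  shows "set_integrable M X g"
proof -
  have "compact (g ` X)"
    using assms compact_X compact_continuous_image continuous_on_subset by blast
  then obtain B where B: "\<And>x. x \<in> X \<Longrightarrow> norm (g x) \<le> B"
    unfolding compact_eq_bounded_closed bounded_iff by blast
  have [measurable]: "g \<in> borel_measurable M"
    using borel_measurable_continuous_onI[OF assms] measurable_cong_sets[OF sets_eq refl] by blast
  have [measurable]: "X \<in> sets M"
    using compact_X sets_eq by (simp add: borel_compact)
  have "integrable M (\<lambda>x. B * (indicat_real X x *\<^sub>R 1))"
    using one_integrable unfolding set_integrable_def by (intro integrable_mult_right)
  then show ?thesis unfolding set_integrable_def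
  proof (rule Bochner_Integration.integrable_bound)
    show "AE x in M. norm (indicat_real X x *\<^sub>R g x) \<le> norm (B * (indicat_real X x *\<^sub>R 1))"
      using B by (intro AE_I2) (auto simp: indicator_def split: if_splits intro: order_trans[OF _ abs_ge_self])
  qed measurable
qed

lemma fourier_coeff_linear:
  assumes "continuous_on UNIV g" "continuous_on UNIV h"
  shows "fourier_coeff (\<lambda>x. u * g x + v * h x) m = u * fourier_coeff g m + v * fourier_coeff h m"
proof -
  have "set_integrable M X (\<lambda>x. u * (g x * e m x))" "set_integrable M X (\<lambda>x. v * (h x * e m x))"
    by (intro continuous_integrable continuous_intros assms e_continuous)+
  then have "(LINT x:X|M. u * (g x * e m x) + v * (h x * e m x))
      = u * fourier_coeff g m + v * fourier_coeff h m"
    by (simp add: fourier_coeff_def)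
  then show ?thesis by (simp add: fourier_coeff_def algebra_simps)
qed

lemma integral_mult_sum:
  assumes "continuous_on UNIV g"
  shows "(LINT x:X|M. g x * (\<Sum>m<N. c m * e m x)) = (\<Sum>m<N. c m * fourier_coeff g m)"
proof (induction N)
  case 0
  then show ?case by (simp add: set_lebesgue_integral_def)
next
  case (Suc N)
  have "set_integrable M X (\<lambda>x. g x * (\<Sum>m<N. c m * e m x))"
    "set_integrable M X (\<lambda>x. c N * (g x * e N x))"
    by (intro continuous_integrable continuous_intros assms e_continuous)+
  then have "(LINT x:X|M. g x * (\<Sum>m<N. c m * e m x) + c N * (g x * e N x))
      = (\<Sum>m<Suc N. c m * fourier_coeff g m)"
    using Suc by (simp add: fourier_coeff_def)
  then show ?case by (simp add: algebra_simps)
qed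

text \<open>
  The square of the distance from \<open>g\<close> to its \<open>N\<close>th Fourier partial sum is nonnegative, and by
  orthonormality it equals the difference of the two sides.
\<close>

lemma bessel:
  assumes g: "continuous_on UNIV g"
  shows "(\<Sum>m<N. (fourier_coeff g m)\<^sup>2) \<le> (LINT x:X|M. (g x)\<^sup>2)"
proof -
  define c where "c = fourier_coeff g"
  define S where "S x = (\<Sum>m<N. c m * e m x)" for x
  have S: "continuous_on UNIV S"
    unfolding S_def by (intro continuous_intros e_continuous)
  have gS: "(LINT x:X|M. g x * S x) = (\<Sum>m<N. (c m)\<^sup>2)"
    unfolding S_def integral_mult_sum[OF g] by (simp add: c_def power2_eq_square)
  have coeff_S: "fourier_coeff S k = c k" if "k < N" for k
  proof -
    have "fourier_coeff S k = (LINT x:X|M. e k x * (\<Sum>m<N. c m * e m x))"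
      by (simp add: fourier_coeff_def S_def mult.commute)
    also have "\<dots> = (\<Sum>m<N. c m * (if k = m then 1 else 0))"
      unfolding integral_mult_sum[OF e_continuous] by (simp add: fourier_coeff_def orthonormal)
    also have "\<dots> = (\<Sum>m<N. if k = m then c m else 0)"
      by (rule sum.cong) auto
    also have "\<dots> = c k"
      using that by simp
    finally show ?thesis .
  qed
  have "(LINT x:X|M. S x * S x) = (\<Sum>m<N. c m * fourier_coeff S m)"
    using integral_mult_sum[OF S] unfolding S_def .
  also have "\<dots> = (\<Sum>m<N. (c m)\<^sup>2)"
    using coeff_S by (simp add: power2_eq_square)
  finally have SS: "(LINT x:X|M. S x * S x) = (\<Sum>m<N. (c m)\<^sup>2)" .
  have "set_integrable M X (\<lambda>x. (g x)\<^sup>2)" "set_integrable M X (\<lambda>x. 2 * (g x * S x))"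
    "set_integrable M X (\<lambda>x. S x * S x)" "set_integrable M X (\<lambda>x. (g x)\<^sup>2 - 2 * (g x * S x))"
    by (intro continuous_integrable continuous_intros g S)+
  then have "(LINT x:X|M. (g x)\<^sup>2 - 2 * (g x * S x) + S x * S x)
      = (LINT x:X|M. (g x)\<^sup>2) - (\<Sum>m<N. (c m)\<^sup>2)"
    by (simp add: gS SS)
  moreover have "0 \<le> (LINT x:X|M. (g x)\<^sup>2 - 2 * (g x * S x) + S x * S x)"
    unfolding set_lebesgue_integral_def
  proof (rule Bochner_Integration.integral_nonneg)
    fix x
    have "(g x)\<^sup>2 - 2 * (g x * S x) + S x * S x = (g x - S x)\<^sup>2"
      by (simp add: power2_eq_square algebra_simps)
    then show "0 \<le> indicat_real X x *\<^sub>R ((g x)\<^sup>2 - 2 * (g x * S x) + S x * S x)" by simp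
  qed
  ultimately show ?thesis by (simp add: c_def)
qed

section \<open>The functional pairing square-summable sequences with Fourier coefficients\<close>

text \<open>
  Cauchy-Schwarz and Bessel; on a set of finite mass the \<open>L\<^sup>2\<close> norm is controlled by the supremum.
\<close>

lemma partial_pairing_bound:
  assumes g: "continuous_on UNIV g" and f: "summable (\<lambda>n. (f n)\<^sup>2)"
    and B: "\<And>x. x \<in> X \<Longrightarrow> \<bar>g x\<bar> \<le> B" "0 \<le> B"
  shows "(\<Sum>m<N. \<bar>f m * fourier_coeff g m\<bar>) \<le> sqrt (\<Sum>n. (f n)\<^sup>2) * sqrt (LINT x:X|M. 1) * B"
proof -
  have "(\<Sum>m<N. \<bar>f m * fourier_coeff g m\<bar>)
      \<le> L2_set f {..<N} * L2_set (fourier_coeff g) {..<N}"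
    using L2_set_mult_ineq by (simp add: abs_mult)
  also have "\<dots> \<le> sqrt (\<Sum>n. (f n)\<^sup>2) * sqrt ((LINT x:X|M. 1) * B\<^sup>2)"
  proof (rule mult_mono)
    show "L2_set f {..<N} \<le> sqrt (\<Sum>n. (f n)\<^sup>2)"
      unfolding L2_set_def using f by (intro real_sqrt_le_mono sum_le_suminf) auto
    have "(LINT x:X|M. (g x)\<^sup>2) \<le> (LINT x:X|M. B\<^sup>2)"
    proof (rule set_integral_mono)
      show "(g x)\<^sup>2 \<le> B\<^sup>2" if "x \<in> X" for x
        using B(1)[OF that] B(2) by (simp add: abs_le_square_iff[symmetric])
    qed (intro continuous_integrable continuous_intros g)+
    also have "\<dots> = (LINT x:X|M. 1) * B\<^sup>2"
      using set_integral_mult_left[of M X "\<lambda>_. 1" "B\<^sup>2"] one_integrable by simp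
    finally show "L2_set (fourier_coeff g) {..<N} \<le> sqrt ((LINT x:X|M. 1) * B\<^sup>2)"
      unfolding L2_set_def using bessel[OF g] by (meson order_trans real_sqrt_le_mono)
  qed (auto simp: suminf_nonneg[OF f])
  also have "\<dots> = sqrt (\<Sum>n. (f n)\<^sup>2) * sqrt (LINT x:X|M. 1) * B"
    using B(2) by (simp add: real_sqrt_mult)
  finally show ?thesis .
qed

lemma pairing_abs_summable:
  assumes g: "continuous_on UNIV g" and f: "summable (\<lambda>n. (f n)\<^sup>2)"
  shows "summable (\<lambda>m. \<bar>f m * fourier_coeff g m\<bar>)"
proof -
  have "compact (g ` X)"
    using g compact_X compact_continuous_image continuous_on_subset by blast
  then obtain B where B: "0 < B" "\<And>x. x \<in> X \<Longrightarrow> \<bar>g x\<bar> \<le> B"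
    unfolding compact_eq_bounded_closed bounded_pos by auto
  show ?thesis
    using partial_pairing_bound[OF g f, of B] B by (intro summableI_nonneg_bounded) auto
qed

lemma pairing_summable:
  assumes "continuous_on UNIV g" and "summable (\<lambda>n. (f n)\<^sup>2)"
  shows "summable (\<lambda>m. f m * fourier_coeff g m)"
  using pairing_abs_summable[OF assms] by (rule summable_rabs_cancel)

lemma pairing_bound:
  assumes g: "continuous_on UNIV g" and f: "summable (\<lambda>n. (f n)\<^sup>2)"
    and B: "\<And>x. x \<in> X \<Longrightarrow> \<bar>g x\<bar> \<le> B" "0 \<le> B"
  shows "\<bar>pairing f g\<bar> \<le> sqrt (\<Sum>n. (f n)\<^sup>2) * sqrt (LINT x:X|M. 1) * B"
proof -
  have "\<bar>pairing f g\<bar> \<le> (\<Sum>m. \<bar>f m * fourier_coeff g m\<bar>)"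
    unfolding pairing_def by (rule summable_rabs[OF pairing_abs_summable[OF g f]])
  also have "\<dots> \<le> sqrt (\<Sum>n. (f n)\<^sup>2) * sqrt (LINT x:X|M. 1) * B"
    by (rule suminf_le_const[OF pairing_abs_summable[OF g f] partial_pairing_bound[OF g f B]])
  finally show ?thesis .
qed

lemma pairing_linear:
  assumes g: "continuous_on UNIV g" and h: "continuous_on UNIV h" and f: "summable (\<lambda>n. (f n)\<^sup>2)"
  shows "pairing f (\<lambda>x. u * g x + v * h x) = u * pairing f g + v * pairing f h"
proof -
  note sg = pairing_summable[OF g f] and sh = pairing_summable[OF h f]
  have "u * pairing f g + v * pairing f h
      = (\<Sum>m. u * (f m * fourier_coeff g m)) + (\<Sum>m. v * (f m * fourier_coeff h m))"
    unfolding pairing_def by (simp add: suminf_mult[OF sg] suminf_mult[OF sh])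
  also have "\<dots> = (\<Sum>m. u * (f m * fourier_coeff g m) + v * (f m * fourier_coeff h m))"
    by (rule suminf_add[OF summable_mult[OF sg] summable_mult[OF sh]])
  finally show ?thesis
    unfolding pairing_def fourier_coeff_linear[OF g h] by (simp add: algebra_simps)
qed

lemma pairing_basis: "pairing f (e n) = f n"
proof -
  have "(\<lambda>m. f m * fourier_coeff (e n) m) = (\<lambda>m. if m = n then f m else 0)"
    by (auto simp: fourier_coeff_def orthonormal)
  then show ?thesis
    unfolding pairing_def using sums_unique[OF sums_single[of n f]] by simp
qed

end

section \<open>Differentiating the exponential under the functional\<close>

lemma has_real_derivative_quadratic_remainder:
  fixes F :: "real \<Rightarrow> real"
  assumes "\<And>u. \<bar>u - t\<bar> \<le> 1 \<Longrightarrow> \<bar>F u - F t - D * (u - t)\<bar> \<le> K * (u - t)\<^sup>2"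
  shows "(F has_real_derivative D) (at t within S)"
proof -
  have "((\<lambda>u. (F u - F t) / (u - t) - D) \<longlongrightarrow> 0) (at t)"
  proof (rule Lim_null_comparison)
    have "eventually (\<lambda>u. dist u t < 1 \<and> u \<noteq> t) (at t)"
      unfolding eventually_at by (intro exI[of _ 1]) auto
    then show "\<forall>\<^sub>F u in at t. norm ((F u - F t) / (u - t) - D) \<le> K * \<bar>u - t\<bar>"
    proof eventually_elim
      case (elim u)
      then have "(F u - F t) / (u - t) - D = (F u - F t - D * (u - t)) / (u - t)"
        by (simp add: field_simps)
      then have "norm ((F u - F t) / (u - t) - D) = \<bar>F u - F t - D * (u - t)\<bar> / \<bar>u - t\<bar>"
        by simp
      also have "\<dots> \<le> K * (u - t)\<^sup>2 / \<bar>u - t\<bar>"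
        using assms[of u] elim by (intro divide_right_mono) (auto simp: dist_real_def)
      also have "\<dots> = K * \<bar>u - t\<bar>"
        using elim by (simp add: power2_eq_square field_simps)
      finally show ?case .
    qed
    show "((\<lambda>u. K * \<bar>u - t\<bar>) \<longlongrightarrow> 0) (at t)"
      by (rule tendsto_eq_intros refl | simp)+
  qed
  then have "((\<lambda>u. (F u - F t) / (u - t)) \<longlongrightarrow> D) (at t)"
    by (rule LIM_zero_cancel)
  then have "(F has_real_derivative D) (at t)"
    by (simp add: has_field_derivative_iff)
  then show ?thesis by (rule has_field_derivative_at_within)
qed

lemma exp_quadratic_remainder:
  fixes z :: real
  shows "\<bar>exp z - 1 - z\<bar> \<le> exp \<bar>z\<bar> * z\<^sup>2"
proof -
  have "(\<Sum>i\<le>1. z ^ i / fact i) = 1 + z" by simp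
  then show ?thesis
    using Taylor_exp_field[of z 1] by (simp add: diff_diff_eq power2_eq_square)
qed

text \<open>
  On the bounded set \<open>X\<close> the first-order Taylor remainder of \<open>\<tau> \<mapsto> exp ((x - s) * \<tau>) * q x\<close> at \<open>t\<close>
  is \<open>O((\<tau> - t)\<^sup>2)\<close> uniformly in \<open>x\<close>, and \<open>pairing_bound\<close> carries this bound over to the remainder
  of the paired function. This replaces a termwise differentiation of the series.
\<close>

lemma (in continuous_orthonormal_system) pairing_exp_derivative:
  assumes q: "continuous_on UNIV q" and f: "summable (\<lambda>n. (f n)\<^sup>2)"
  shows "((\<lambda>\<tau>. pairing f (\<lambda>x. exp ((x - s) * \<tau>) * q x)) has_real_derivative
      pairing f (\<lambda>x. (x - s) * (exp ((x - s) * t) * q x))) (at t within S)"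
proof -
  define G where "G \<tau> x = exp ((x - s) * \<tau>) * q x" for \<tau> x
  have G: "continuous_on UNIV (G \<tau>)" for \<tau>
    unfolding G_def by (intro continuous_intros q)
  have G': "continuous_on UNIV (\<lambda>x. (x - s) * G t x)"
    by (intro continuous_intros G)
  have "compact ((\<lambda>x. x - s) ` X)" "compact (G t ` X)"
    using compact_X by (auto intro!: compact_continuous_image continuous_on_diff
        continuous_on_id continuous_on_const intro: continuous_on_subset[OF G])
  then obtain R B where R: "R > 0" "\<And>x. x \<in> X \<Longrightarrow> \<bar>x - s\<bar> \<le> R"
    and B: "B > 0" "\<And>x. x \<in> X \<Longrightarrow> \<bar>G t x\<bar> \<le> B"
    unfolding compact_eq_bounded_closed bounded_pos by auto
  define C where "C = sqrt (\<Sum>n. (f n)\<^sup>2) * sqrt (LINT x:X|M. 1)"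
  have "((\<lambda>\<tau>. pairing f (G \<tau>)) has_real_derivative pairing f (\<lambda>x. (x - s) * G t x)) (at t within S)"
  proof (rule has_real_derivative_quadratic_remainder[where K = "C * (B * (exp R * R\<^sup>2))"])
    fix u assume u: "\<bar>u - t\<bar> \<le> 1"
    define h where "h = u - t"
    \<comment> \<open>The Taylor remainder, with factors 1 so that \<open>pairing_linear\<close> matches syntactically.\<close>
    define r where "r x = 1 * (1 * G u x + (- 1) * G t x) + (- h) * ((x - s) * G t x)" for x
    have "continuous_on UNIV (\<lambda>x. 1 * G u x + (- 1) * G t x)"
      by (intro continuous_intros G)
    then have "pairing f r = 1 * (1 * pairing f (G u) + (- 1) * pairing f (G t))
        + (- h) * pairing f (\<lambda>x. (x - s) * G t x)"
      unfolding r_def by (simp only: pairing_linear G G' f)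
    then have eq: "pairing f (G u) - pairing f (G t) - pairing f (\<lambda>x. (x - s) * G t x) * (u - t)
        = pairing f r"
      by (simp add: h_def algebra_simps)
    have r_cont: "continuous_on UNIV r"
      unfolding r_def by (intro continuous_intros G)
    have "\<bar>r x\<bar> \<le> B * (exp R * R\<^sup>2) * h\<^sup>2" if x: "x \<in> X" for x
    proof -
      define z where "z = (x - s) * h"
      have "(x - s) * u = (x - s) * t + z"
        by (simp add: z_def h_def algebra_simps)
      then have "G u x = G t x * exp z"
        by (simp add: G_def exp_add)
      then have r: "r x = G t x * (exp z - 1 - z)"
        by (simp add: r_def z_def algebra_simps)
      have "\<bar>exp z - 1 - z\<bar> \<le> exp R * (R\<^sup>2 * h\<^sup>2)"
      proof (rule order_trans[OF exp_quadratic_remainder], rule mult_mono)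
        have "\<bar>z\<bar> \<le> R * 1"
          unfolding z_def abs_mult using R x u by (intro mult_mono) (auto simp: h_def)
        then show "exp \<bar>z\<bar> \<le> exp R" by simp
        have "(x - s)\<^sup>2 \<le> R\<^sup>2"
          using R x by (simp add: abs_le_square_iff[symmetric])
        then show "z\<^sup>2 \<le> R\<^sup>2 * h\<^sup>2"
          unfolding z_def power_mult_distrib by (rule mult_right_mono) simp
      qed auto
      then have "\<bar>r x\<bar> \<le> B * (exp R * (R\<^sup>2 * h\<^sup>2))"
        using B x unfolding r abs_mult by (intro mult_mono) auto
      then show ?thesis by (simp add: mult.assoc)
    qed
    then have "\<bar>pairing f r\<bar> \<le> C * (B * (exp R * R\<^sup>2) * h\<^sup>2)"
      unfolding C_def using B(1) by (intro pairing_bound r_cont f) auto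
    then show "\<bar>pairing f (G u) - pairing f (G t) - pairing f (\<lambda>x. (x - s) * G t x) * (u - t)\<bar>
        \<le> C * (B * (exp R * R\<^sup>2)) * (u - t)\<^sup>2"
      unfolding eq by (simp add: h_def mult.assoc)
  qed
  then show ?thesis unfolding G_def[abs_def] .
qed

section \<open>The heat semigroup of a Jacobi matrix\<close>

text \<open>
  The total mass of the support is finite because \<open>p 0\<close> is a constant whose square has
  integral 1, and a non-integrable function has Bochner integral 0.
\<close>

lemma spectral_pair_orthonormal_system:
  assumes "spectral_pair a b M p"
  shows "continuous_orthonormal_system M (measure_support M) (\<lambda>m. poly (p m))"
proof
  let ?X = "measure_support M"
  show "sets M = sets borel" "compact ?X"
    using assms by (auto simp: spectral_pair_def)
  show orth: "(LINT x:?X|M. poly (p n) x * poly (p m) x) = (if n = m then 1 else 0)" for n m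
    using assms unfolding spectral_pair_def by blast
  show "continuous_on UNIV (poly (p m))" for m
    by (intro continuous_intros)
  have "degree (p 0) = 0"
    using assms unfolding spectral_pair_def by blast
  then obtain c where c: "p 0 = [:c:]"
    by (rule degree_eq_zeroE)
  have int_c: "(LINT x:?X|M. c * c) = 1"
    using orth[of 0 0] by (simp add: c)
  then have "c \<noteq> 0"
    by (auto simp: set_lebesgue_integral_def)
  have "integrable M (\<lambda>x. indicat_real ?X x *\<^sub>R (c * c))"
    using int_c not_integrable_integral_eq unfolding set_lebesgue_integral_def by fastforce
  then have "integrable M (\<lambda>x. inverse (c * c) * (indicat_real ?X x *\<^sub>R (c * c)))"
    by (rule integrable_mult_right)
  moreover have "(\<lambda>x. inverse (c * c) * (indicat_real ?X x *\<^sub>R (c * c))) = (\<lambda>x. indicat_real ?X x *\<^sub>R 1)"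
    using \<open>c \<noteq> 0\<close> by (auto simp: fun_eq_iff field_simps)
  ultimately show "set_integrable M ?X (\<lambda>_. 1 :: real)"
    using \<open>c \<noteq> 0\<close> unfolding set_integrable_def by simp
qed

theorem mainTheorem2:
  fixes a b :: "nat \<Rightarrow> real" and \<alpha> \<beta> :: real
    and M :: "real measure" and p :: "nat \<Rightarrow> real poly" and f :: "nat \<Rightarrow> real"
  assumes "\<And>n. a n > 0"
    and "a \<longlonglongrightarrow> \<alpha>" and "b \<longlonglongrightarrow> \<beta>"
    and "spectral_pair a b M p"
    and "summable (\<lambda>n. (f n)\<^sup>2)"
  shows "(\<forall>t\<ge>0. \<forall>m n. set_integrable M (measure_support M) (heat_integrand M p t m n)) \<and>
         (\<forall>t\<ge>0. \<forall>n. summable (\<lambda>m. f m * heat_kernel M p t m n)) \<and>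
         (\<forall>t\<ge>0. \<forall>n. ((\<lambda>\<tau>. heat_op M p \<tau> f n) has_real_derivative
             jacobi_shifted a b M (heat_op M p t f) n) (at t within {0..})) \<and>
         (\<forall>n. heat_op M p 0 f n = f n)"
proof -
  interpret continuous_orthonormal_system M "measure_support M" "\<lambda>m. poly (p m)"
    using assms(4) by (rule spectral_pair_orthonormal_system)
  note f = assms(5)
  define s where "s = s_plus M"
  define G where "G t n x = exp ((x - s) * t) * poly (p n) x" for t n x
  have G: "continuous_on UNIV (G t n)" for t n
    unfolding G_def by (intro continuous_intros)
  have kernel: "heat_kernel M p t m n = fourier_coeff (G t n) m" for t m n
    by (simp add: heat_kernel_def heat_integrand_def fourier_coeff_def G_def s_def mult_ac)
  have op: "heat_op M p t f n = pairing f (G t n)" for t n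
    by (simp add: heat_op_def pairing_def kernel)
  have integrable: "set_integrable M (measure_support M) (heat_integrand M p t m n)" for t m n
    unfolding heat_integrand_def by (intro continuous_integrable continuous_intros)
  have summable: "summable (\<lambda>m. f m * heat_kernel M p t m n)" for t n
    unfolding kernel by (rule pairing_summable[OF G f])
  have generator: "pairing f (\<lambda>x. (x - s) * G t n x) = jacobi_shifted a b M (heat_op M p t f) n" for t n
  proof -
    \<comment> \<open>For \<open>n = 0\<close> the index \<open>n - 1\<close> is again 0, so the coefficient has to vanish.\<close>
    define c where "c = (if n = 0 then 0 else a (n - 1))"
    have rec: "x * poly (p n) x = c * poly (p (n - 1)) x + b n * poly (p n) x + a n * poly (p (n + 1)) x" for x
      using assms(4) unfolding spectral_pair_def c_def by (cases "n = 0") auto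
    \<comment> \<open>Nested so that two applications of \<open>pairing_linear\<close> match syntactically.\<close>
    have "(x - s) * G t n x
        = 1 * (c * G t (n - 1) x + (b n - s) * G t n x) + a n * G t (n + 1) x" for x
    proof -
      have "(x - s) * G t n x = exp ((x - s) * t) * (x * poly (p n) x) - s * G t n x"
        by (simp add: G_def algebra_simps)
      then show ?thesis
        unfolding rec by (simp add: G_def distrib_left left_diff_distrib mult_ac)
    qed
    moreover have "continuous_on UNIV (\<lambda>x. c * G t (n - 1) x + (b n - s) * G t n x)"
      by (intro continuous_intros G)
    ultimately have "pairing f (\<lambda>x. (x - s) * G t n x)
        = 1 * (c * pairing f (G t (n - 1)) + (b n - s) * pairing f (G t n)) + a n * pairing f (G t (n + 1))"
      by (simp only: pairing_linear G f)
    then show ?thesis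
      by (simp add: jacobi_shifted_def jacobi_def op c_def s_def algebra_simps)
  qed
  have deriv: "((\<lambda>\<tau>. heat_op M p \<tau> f n) has_real_derivative
      jacobi_shifted a b M (heat_op M p t f) n) (at t within {0..})" for t n
    unfolding op generator[symmetric] unfolding G_def
    by (rule pairing_exp_derivative[OF _ f]) (intro continuous_intros)
  have "G 0 n = poly (p n)" for n
    by (simp add: G_def fun_eq_iff)
  then have "heat_op M p 0 f n = f n" for n
    by (simp add: op pairing_basis)
  with integrable summable deriv show ?thesis by blast
qed

end
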